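(* Let $x$ be any JumpOpt local optimum of an instance of the scheduling problem $P\,|\,\mathcal M_j\,|\sum w_jC_j$, and let $x^*$ be an optimal assignment of the same instance. Then there exists a feasible solution of (SDP-SR) with objective value at least $\frac{2}{3+\sqrt5}\,\big(2C(x)-C(x^* )\big)$. By weak duality, this implies that the approximation ratio of $x$ is at most $\frac{5+\sqrt5}{4}\approx 1.809$, i.e. $C(x)\le\frac{5+\sqrt5}{4}\,C(x^* )$.
   Context: $P\,|\,\mathcal M_j\,|\sum w_jC_j$: a finite set $J$ of jobs with weights $w_j\ge 0$ and sizes $p_j\ge0$, a finite set $M$ of machines, processing times $p_{ij}\in\{p_j,\infty\}$ for $i\in M$, $j\in J$, and $\mathcal S_j=\{i\in M:p_{ij}<\infty\}\neq\emptyset$. Smith ratios: $\delta_{ij}=p_{ij}/w_j$, read as $+\infty$ if $w_j=0$. For each machine $i$, $\prec_i$ is a strict total order on $J$ such that $k\prec_i j$ implies $\delta_{ik}\le\delta_{ij}$ (ties broken consistently). An assignment is $x\in\{0,1\}^{M\times J}$ with $\sum_{i\in\mathcal S_j}x_{ij}=1$ and $x_{ij}=0$ for $i\notin\mathcal S_j$, for every $j\in J$. Completion times: $C_j(x)=\sum_{i\in M}x_{ij}\big(p_{ij}+\sum_{k\prec_i j}p_{ik}x_{ik}\big)$. Cost: $C(x)=\sum_{j\in J}w_jC_j(x)$. Any term with a zero factor $x_{ij}$ or $w_j$ is read as $0$. An optimal assignment minimizes $C$. JumpOpt: an assignment $x$ such that moving any single job to any other of its feasible machines does not strictly decrease $C$.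 (SDP-SR): the variables are reals $y_j$ $(j\in J)$ and vectors $v_0,v_{ij}\in\mathbb R^d$ $(j\in J,i\in\mathcal S_j)$ for some $d\in\mathbb N$, with the standard inner product. Maximize $\sum_{j\in J}y_j-\frac12\|v_0\|^2$ subject to $y_j\le w_jp_{ij}-\frac12\|v_{ij}\|^2+\langle v_0,v_{ij}\rangle$ for all $j\in J$, $i\in\mathcal S_j$; and $\langle v_{ij},v_{i'k}\rangle\le w_jw_k\min\{\delta_{ij},\delta_{ik}\}\,\mathbf 1_{\{i=i'\}}$ for all $(i,j)\ne(i',k)$ with $j,k\in J$, $i\in\mathcal S_j$, $i'\in\mathcal S_k$ (right-hand side $0$ if $i\ne i'$). *)

theory Defs
  imports
    Complex_Main
    "HOL-Library.Extended_Real"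
    "Jordan_Normal_Form.Matrix"
begin

record ('m, 'j) sched =
  machines :: "'m set"
  jobs :: "'j set"
  weight :: "'j \<Rightarrow> real"
  job_size :: "'j \<Rightarrow> real"
  ptime :: "'m \<Rightarrow> 'j \<Rightarrow> ereal"
  prec :: "'m \<Rightarrow> 'j rel"

definition feasible_machines :: "('m, 'j) sched \<Rightarrow> 'j \<Rightarrow> 'm set" where
  "feasible_machines I j = {i \<in> machines I. ptime I i j < \<infinity>}"

text \<open>The case distinction is needed because \<^term>\<open>0 / 0 = (0 :: ereal)\<close>.\<close>

definition smith_ratio :: "('m, 'j) sched \<Rightarrow> 'm \<Rightarrow> 'j \<Rightarrow> ereal" where
  "smith_ratio I i j =
     (if weight I j = 0 then \<infinity> else ptime I i j / ereal (weight I j))"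

text \<open>\<^term>\<open>(k, j) \<in> prec I i\<close> means that job \<open>k\<close> precedes job \<open>j\<close> on machine \<open>i\<close>.\<close>

definition sched_instance :: "('m, 'j) sched \<Rightarrow> bool" where
  "sched_instance I \<longleftrightarrow>
     finite (machines I) \<and> finite (jobs I) \<and>
     (\<forall>j \<in> jobs I. 0 \<le> weight I j \<and> 0 \<le> job_size I j) \<and>
     (\<forall>i \<in> machines I. \<forall>j \<in> jobs I. ptime I i j \<in> {ereal (job_size I j), \<infinity>}) \<and>
     (\<forall>j \<in> jobs I. feasible_machines I j \<noteq> {}) \<and>
     (\<forall>i \<in> machines I.
        prec I i \<subseteq> jobs I \<times> jobs I \<and> strict_linear_order_on (jobs I) (prec I i) \<and>
        (\<forall>k j. (k, j) \<in> prec I i \<longrightarrow> smith_ratio I i k \<le> smith_ratio I i j))"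

definition assignment :: "('m, 'j) sched \<Rightarrow> ('m \<Rightarrow> 'j \<Rightarrow> real) \<Rightarrow> bool" where
  "assignment I x \<longleftrightarrow>
     (\<forall>i \<in> machines I. \<forall>j \<in> jobs I. x i j \<in> {0, 1}) \<and>
     (\<forall>j \<in> jobs I. (\<Sum>i \<in> feasible_machines I j. x i j) = 1 \<and>
                (\<forall>i \<in> machines I - feasible_machines I j. x i j = 0))"

text \<open>Terms with a zero factor vanish, as \<^term>\<open>0 * \<infinity> = (0 :: ereal)\<close>.\<close>

definition completion_time :: "('m, 'j) sched \<Rightarrow> ('m \<Rightarrow> 'j \<Rightarrow> real) \<Rightarrow> 'j \<Rightarrow> ereal" where
  "completion_time I x j =
     (\<Sum>i \<in> machines I. ereal (x i j) *
        (ptime I i j + (\<Sum>k \<in> {k \<in> jobs I. (k, j) \<in> prec I i}. ptime I i k * ereal (x i k))))"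

definition cost :: "('m, 'j) sched \<Rightarrow> ('m \<Rightarrow> 'j \<Rightarrow> real) \<Rightarrow> ereal" where
  "cost I x = (\<Sum>j \<in> jobs I. ereal (weight I j) * completion_time I x j)"

definition optimal_assignment :: "('m, 'j) sched \<Rightarrow> ('m \<Rightarrow> 'j \<Rightarrow> real) \<Rightarrow> bool" where
  "optimal_assignment I x \<longleftrightarrow>
     assignment I x \<and> (\<forall>x'. assignment I x' \<longrightarrow> cost I x \<le> cost I x')"

definition move_job :: "('m \<Rightarrow> 'j \<Rightarrow> real) \<Rightarrow> 'j \<Rightarrow> 'm \<Rightarrow> 'm \<Rightarrow> 'j \<Rightarrow> real" where
  "move_job x j i = (\<lambda>i' k. if k = j then (if i' = i then 1 else 0) else x i' k)"

definition jump_opt :: "('m, 'j) sched \<Rightarrow> ('m \<Rightarrow> 'j \<Rightarrow> real) \<Rightarrow> bool" where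
  "jump_opt I x \<longleftrightarrow>
     assignment I x \<and>
     (\<forall>j \<in> jobs I. \<forall>i \<in> feasible_machines I j.
        x i j = 0 \<longrightarrow> \<not> cost I (move_job x j i) < cost I x)"

text \<open>Squared Euclidean norms are written as \<^term>\<open>u \<bullet> u\<close>.\<close>

definition sdp_objective :: "('m, 'j) sched \<Rightarrow> ('j \<Rightarrow> real) \<Rightarrow> real vec \<Rightarrow> real" where
  "sdp_objective I y v0 = (\<Sum>j \<in> jobs I. y j) - 1 / 2 * (v0 \<bullet> v0)"

definition sdp_feasible ::
    "('m, 'j) sched \<Rightarrow> nat \<Rightarrow> ('j \<Rightarrow> real) \<Rightarrow> real vec \<Rightarrow> ('m \<Rightarrow> 'j \<Rightarrow> real vec) \<Rightarrow> bool" where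
  "sdp_feasible I d y v0 v \<longleftrightarrow>
     v0 \<in> carrier_vec d \<and>
     (\<forall>j \<in> jobs I. \<forall>i \<in> feasible_machines I j. v i j \<in> carrier_vec d) \<and>
     (\<forall>j \<in> jobs I. \<forall>i \<in> feasible_machines I j.
        ereal (y j) \<le> ereal (weight I j) * ptime I i j
          - ereal (1 / 2 * (v i j \<bullet> v i j)) + ereal (v0 \<bullet> v i j)) \<and>
     (\<forall>j \<in> jobs I. \<forall>k \<in> jobs I. \<forall>i \<in> feasible_machines I j. \<forall>i' \<in> feasible_machines I k.
        (i, j) \<noteq> (i', k) \<longrightarrow>
        ereal (v i j \<bullet> v i' k) \<le>
          (if i = i'
           then ereal (weight I j * weight I k) * min (smith_ratio I i j) (smith_ratio I i k)
           else 0))"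

end

theory Submission
  imports Defs
begin

text \<open>
  The kernel \<open>K j k = w\<^sub>j w\<^sub>k min \<delta>\<^sub>j \<delta>\<^sub>k\<close> is a Gram matrix, \<open>K j k = \<langle>e\<^sub>j, e\<^sub>k\<rangle>\<close>, and with
  \<open>F\<^sub>i = \<Sum>j. x\<^sub>i\<^sub>j e\<^sub>j\<close> the cost is \<open>C(x) = (W + \<Sum>i. \<parallel>F\<^sub>i\<parallel>\<^sup>2) / 2\<close> where \<open>W = \<Sum>j. w\<^sub>j p\<^sub>j\<close>.
  If job \<open>j\<close> sits on machine \<open>m\<close>, local optimality says
  \<open>\<langle>F\<^sub>m, e\<^sub>j\<rangle> \<le> w\<^sub>j p\<^sub>j + \<langle>F\<^sub>i, e\<^sub>j\<rangle>\<close> for every feasible machine \<open>i\<close>. Taking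
  \<open>v\<^sub>i\<^sub>j = \<beta> e\<^sub>j\<close> in the \<open>i\<close>-th orthogonal copy of the space, \<open>v\<^sub>0 = \<alpha> \<Sum>i. F\<^sub>i\<close> and
  \<open>y\<^sub>j = \<alpha>\<beta> \<langle>F\<^sub>m, e\<^sub>j\<rangle>\<close>, feasibility amounts to \<open>\<beta>\<^sup>2 / 2 + \<alpha>\<beta> \<le> 1\<close> and \<open>\<beta> \<le> 1\<close>, and the objective is
  \<open>(\<alpha>\<beta> - \<alpha>\<^sup>2 / 2) (2 C(x) - W)\<close>. The best \<open>\<alpha>, \<beta>\<close> make the factor \<open>2 / (3 + \<surd>5)\<close>,
  and \<open>W \<le> C(x*)\<close>.
\<close>

section \<open>The Smith kernel and its relation to the machine orders\<close>

text \<open>If a weight is \<open>0\<close>, the junk value of the quotient is harmless: the kernel is \<open>0\<close>.\<close>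

definition smith_kernel :: "('m, 'j) sched \<Rightarrow> 'j \<Rightarrow> 'j \<Rightarrow> real" where
  "smith_kernel I j k =
     weight I j * weight I k * min (job_size I j / weight I j) (job_size I k / weight I k)"

definition total_work :: "('m, 'j) sched \<Rightarrow> real" where
  "total_work I = (\<Sum>j\<in>jobs I. weight I j * job_size I j)"

text \<open>This is the inner product of \<open>F_i\<close> and \<open>e_j\<close> from the
  overview. The summand \<open>k = j\<close> is included, so a job also interacts with itself on its
  own machine.\<close>

definition interaction :: "('m, 'j) sched \<Rightarrow> ('m \<Rightarrow> 'j \<Rightarrow> real) \<Rightarrow> 'm \<Rightarrow> 'j \<Rightarrow> real" where
  "interaction I x i j = (\<Sum>k\<in>jobs I. x i k * smith_kernel I j k)"

lemma smith_kernel_commute: "smith_kernel I j k = smith_kernel I k j"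
  by (simp add: smith_kernel_def min.commute mult.commute)

lemma smith_kernel_self: "smith_kernel I j j = weight I j * job_size I j"
  by (simp add: smith_kernel_def)

lemma smith_kernel_nonneg:
  assumes "sched_instance I" "j \<in> jobs I" "k \<in> jobs I"
  shows "0 \<le> smith_kernel I j k"
  using assms by (simp add: smith_kernel_def sched_instance_def)

lemma feasible_ptime:
  assumes "sched_instance I" "j \<in> jobs I" "i \<in> feasible_machines I j"
  shows "ptime I i j = ereal (job_size I j)"
  using assms by (fastforce simp: sched_instance_def feasible_machines_def)

text \<open>A zero weight annihilates both sides, even against an infinite ratio. Otherwise
  feasibility makes both ratios finite and the \<open>ereal\<close> minimum is the real one.\<close>

lemma weighted_min_smith_ratio:
  assumes "sched_instance I" "j \<in> jobs I" "k \<in> jobs I"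
    "i \<in> feasible_machines I j" "i \<in> feasible_machines I k"
  shows "ereal (weight I j * weight I k) * min (smith_ratio I i j) (smith_ratio I i k)
         = ereal (smith_kernel I j k)"
proof (cases "weight I j = 0 \<or> weight I k = 0")
  case True
  then show ?thesis
    by (auto simp: smith_kernel_def zero_ereal_def[symmetric])
next
  case False
  then show ?thesis
    by (simp add: smith_ratio_def smith_kernel_def feasible_ptime[OF assms(1)] assms
        min_def)
qed

text \<open>The predecessor \<open>k\<close> has the smaller Smith ratio and attains the minimum, so
  \<open>weight I k\<close> cancels. This turns waiting costs into kernel values.\<close>

lemma prec_weight_job_size:
  assumes I: "sched_instance I" and i: "i \<in> machines I" and kj: "(k, j) \<in> prec I i"
    and fj: "i \<in> feasible_machines I j" and fk: "i \<in> feasible_machines I k"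
  shows "weight I j * job_size I k = smith_kernel I j k"
proof (cases "weight I j = 0")
  case True
  then show ?thesis by (simp add: smith_kernel_def)
next
  case False
  have J: "j \<in> jobs I" "k \<in> jobs I" and le: "smith_ratio I i k \<le> smith_ratio I i j"
    using I i kj by (auto simp: sched_instance_def)
  \<comment> \<open>A zero weight would give \<open>k\<close> an infinite ratio, above the finite
    ratio of \<open>j\<close>.\<close>
  have wk: "weight I k \<noteq> 0"
    using le False J fj by (auto simp: smith_ratio_def feasible_ptime[OF I])
  have "job_size I k / weight I k \<le> job_size I j / weight I j"
    using le False wk by (simp add: smith_ratio_def feasible_ptime[OF I] J fj fk)
  then have "min (job_size I j / weight I j) (job_size I k / weight I k) = job_size I k / weight I k"
    by (rule min_absorb2)
  then show ?thesis using wk by (simp add: smith_kernel_def)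
qed

section \<open>Assignments as maps from jobs to machines\<close>

lemma assignment_ptime:
  assumes "sched_instance I" "assignment I x" "i \<in> machines I" "j \<in> jobs I"
  shows "ptime I i j * ereal (x i j) = ereal (job_size I j * x i j)"
proof (cases "i \<in> feasible_machines I j")
  case True
  then show ?thesis using assms by (simp add: feasible_ptime)
next
  case False
  then show ?thesis using assms by (simp add: assignment_def zero_ereal_def[symmetric])
qed

lemma assignment_sum_machines:
  assumes "sched_instance I" "assignment I x" "j \<in> jobs I"
  shows "(\<Sum>i\<in>machines I. x i j) = 1"
proof -
  have "(\<Sum>i\<in>feasible_machines I j. x i j) = (\<Sum>i\<in>machines I. x i j)"
    using assms by (intro sum.mono_neutral_left)
      (auto simp: sched_instance_def assignment_def feasible_machines_def)
  then show ?thesis using assms by (simp add: assignment_def)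
qed

lemma assignment_obtain_machine:
  assumes I: "sched_instance I" and x: "assignment I x"
  obtains \<sigma> where "\<And>j. j \<in> jobs I \<Longrightarrow> \<sigma> j \<in> feasible_machines I j"
    "\<And>i j. j \<in> jobs I \<Longrightarrow> i \<in> machines I \<Longrightarrow> x i j = (if i = \<sigma> j then 1 else 0)"
proof -
  have "\<exists>m. m \<in> feasible_machines I j \<and> (\<forall>i\<in>machines I. x i j = (if i = m then 1 else 0))"
    if j: "j \<in> jobs I" for j
  proof -
    have fin: "finite (machines I)" using I by (simp add: sched_instance_def)
    have s: "(\<Sum>i\<in>machines I. x i j) = 1" using assignment_sum_machines[OF I x j] .
    have b: "\<And>i. i \<in> machines I \<Longrightarrow> x i j = 0 \<or> x i j = 1"
      using x j by (auto simp: assignment_def)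
    obtain m where m: "m \<in> machines I" "x m j \<noteq> 0"
      using s by (metis sum.neutral zero_neq_one)
    have mf: "m \<in> feasible_machines I j" using x j m by (auto simp: assignment_def)
    have "(\<Sum>i\<in>machines I - {m}. x i j) = 0"
      using s m b[OF m(1)] fin by (simp add: sum.remove)
    moreover have "\<And>i. i \<in> machines I - {m} \<Longrightarrow> 0 \<le> x i j"
      using b by force
    ultimately have "\<forall>i\<in>machines I - {m}. x i j = 0"
      using fin by (subst (asm) sum_nonneg_eq_0_iff) auto
    then show ?thesis using mf m b[OF m(1)] by auto
  qed
  then show ?thesis using that by metis
qed

section \<open>The cost as a quadratic form\<close>

text \<open>Every pair is either diagonal or ordered in exactly one direction, and by symmetry of
  \<open>f\<close> the two directions contribute equally.\<close>

lemma sum_strict_linear_order_symmetric: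
  fixes f :: "'a \<Rightarrow> 'a \<Rightarrow> real"
  assumes fin: "finite A" and sub: "r \<subseteq> A \<times> A" and lin: "strict_linear_order_on A r"
    and comm: "\<And>a b. f a b = f b a"
  shows "(\<Sum>a\<in>A. \<Sum>b\<in>A. f a b) = (\<Sum>a\<in>A. f a a) + 2 * (\<Sum>a\<in>A. \<Sum>b\<in>{b\<in>A. (b, a) \<in> r}. f a b)"
proof -
  have tri: "f a b = (if b = a then f a b else 0) + (if (b, a) \<in> r then f a b else 0)
      + (if (a, b) \<in> r then f a b else 0)" if "a \<in> A" "b \<in> A" for a b
    using lin that unfolding strict_linear_order_on_def total_on_def irrefl_def
    by (smt (verit) transD)
  have "(\<Sum>a\<in>A. \<Sum>b\<in>A. f a b)
      = (\<Sum>a\<in>A. \<Sum>b\<in>A. (if b = a then f a b else 0)) + (\<Sum>a\<in>A. \<Sum>b\<in>A. if (b, a) \<in> r then f a b else 0)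
      + (\<Sum>a\<in>A. \<Sum>b\<in>A. if (a, b) \<in> r then f a b else 0)"
    unfolding sum.distrib[symmetric] by (intro sum.cong refl tri)
  also have "(\<Sum>a\<in>A. \<Sum>b\<in>A. if (a, b) \<in> r then f a b else 0)
      = (\<Sum>a\<in>A. \<Sum>b\<in>A. if (b, a) \<in> r then f a b else 0)"
    by (subst sum.swap) (intro sum.cong refl if_cong comm)
  also have "(\<Sum>a\<in>A. \<Sum>b\<in>A. if (b, a) \<in> r then f a b else 0)
      = (\<Sum>a\<in>A. \<Sum>b\<in>{b\<in>A. (b, a) \<in> r}. f a b)"
    by (simp only: sum.inter_filter[OF fin])
  also have "(\<Sum>a\<in>A. \<Sum>b\<in>A. (if b = a then f a b else 0)) = (\<Sum>a\<in>A. f a a)"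
    using fin by simp
  finally show ?thesis by simp
qed

text \<open>With W the total work and Q the double sum, processing contributes W and waiting
  contributes the kernel over ordered pairs on a common machine. Symmetrizing makes the latter (Q -
  W) / 2, as the diagonal of Q is W.\<close>

lemma cost_eq_interaction:
  assumes I: "sched_instance I" and x: "assignment I x"
  shows "cost I x =
    ereal ((total_work I + (\<Sum>i\<in>machines I. \<Sum>j\<in>jobs I. x i j * interaction I x i j)) / 2)"
proof -
  define pre where "pre i j = {k \<in> jobs I. (k, j) \<in> prec I i}" for i j
  define P where "P i j = (\<Sum>k\<in>pre i j. x i j * x i k * smith_kernel I j k)" for i j
  define S where "S i j = (\<Sum>k\<in>pre i j. job_size I k * x i k)" for i j
  have real_term: "ereal (x i j) * (ptime I i j + (\<Sum>k\<in>pre i j. ptime I i k * ereal (x i k)))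
      = ereal (x i j * (job_size I j + S i j))"
    if i: "i \<in> machines I" and j: "j \<in> jobs I" for i j
  proof (cases "i \<in> feasible_machines I j")
    case False
    then have "x i j = 0" using x i j by (auto simp: assignment_def)
    then show ?thesis by (simp add: zero_ereal_def[symmetric])
  next
    case True
    have "(\<Sum>k\<in>pre i j. ptime I i k * ereal (x i k)) = ereal (S i j)"
      using assignment_ptime[OF I x i] by (simp add: S_def pre_def flip: sum_ereal)
    then show ?thesis by (simp add: feasible_ptime[OF I j True])
  qed
  have weighted: "weight I j * (x i j * (job_size I j + S i j))
      = x i j * (weight I j * job_size I j) + P i j"
    if i: "i \<in> machines I" and j: "j \<in> jobs I" for i j
  proof -
    \<comment> \<open>If the machine is infeasible for one of the two jobs, a zero entry of
      \<open>x\<close> kills both sides; otherwise the order on the machine yields the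
      kernel.\<close>
    have eq: "weight I j * (x i j * (job_size I k * x i k)) = x i j * x i k * smith_kernel I j k"
      if k: "k \<in> pre i j" for k
    proof (cases "i \<in> feasible_machines I j \<and> i \<in> feasible_machines I k")
      case False
      then have "x i j = 0 \<or> x i k = 0" using x i j k by (auto simp: assignment_def pre_def)
      then show ?thesis by auto
    next
      case True
      then show ?thesis
        using prec_weight_job_size[OF I i, of k j] k by (simp add: pre_def flip: mult.assoc)
    qed
    have "weight I j * (x i j * S i j) = P i j"
      unfolding P_def S_def sum_distrib_left by (intro sum.cong refl eq)
    then show ?thesis by (simp add: algebra_simps)
  qed
  have "cost I x = (\<Sum>j\<in>jobs I. ereal (weight I j *
      (\<Sum>i\<in>machines I. x i j * (job_size I j + S i j))))"
    unfolding cost_def completion_time_def pre_def[symmetric]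
    by (intro sum.cong refl) (simp add: real_term)
  also have "\<dots> = (\<Sum>j\<in>jobs I. \<Sum>i\<in>machines I. ereal (x i j * (weight I j * job_size I j) + P i j))"
    unfolding sum_distrib_left by (simp add: weighted)
  also have "\<dots> = ereal (\<Sum>j\<in>jobs I. \<Sum>i\<in>machines I. x i j * (weight I j * job_size I j) + P i j)"
    by simp
  also have "(\<Sum>j\<in>jobs I. \<Sum>i\<in>machines I. x i j * (weight I j * job_size I j) + P i j)
      = (\<Sum>j\<in>jobs I. \<Sum>i\<in>machines I. x i j * (weight I j * job_size I j))
        + (\<Sum>i\<in>machines I. \<Sum>j\<in>jobs I. P i j)"
    by (simp add: sum.distrib) (rule sum.swap)
  also have "(\<Sum>j\<in>jobs I. \<Sum>i\<in>machines I. x i j * (weight I j * job_size I j)) = total_work I"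
    unfolding total_work_def sum_distrib_right[symmetric]
    by (simp add: assignment_sum_machines[OF I x])
  also have "(\<Sum>i\<in>machines I. \<Sum>j\<in>jobs I. P i j)
     = ((\<Sum>i\<in>machines I. \<Sum>j\<in>jobs I. x i j * interaction I x i j) - total_work I) / 2"
  proof -
    have "(\<Sum>j\<in>jobs I. x i j * interaction I x i j)
        = (\<Sum>j\<in>jobs I. x i j * (weight I j * job_size I j)) + 2 * (\<Sum>j\<in>jobs I. P i j)"
      if i: "i \<in> machines I" for i
    proof -
      have "(\<Sum>j\<in>jobs I. x i j * interaction I x i j)
          = (\<Sum>j\<in>jobs I. \<Sum>k\<in>jobs I. x i j * x i k * smith_kernel I j k)"
        by (simp add: interaction_def sum_distrib_left mult.assoc)
      also have "\<dots> = (\<Sum>j\<in>jobs I. x i j * x i j * smith_kernel I j j) + 2 * (\<Sum>j\<in>jobs I. P i j)"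
        unfolding P_def pre_def using I i
        by (intro sum_strict_linear_order_symmetric)
          (auto simp: sched_instance_def smith_kernel_commute mult.commute)
      \<comment> \<open>The entries of \<open>x\<close> are 0 or 1, hence idempotent.\<close>
      also have "(\<Sum>j\<in>jobs I. x i j * x i j * smith_kernel I j j)
          = (\<Sum>j\<in>jobs I. x i j * (weight I j * job_size I j))"
        using x i by (intro sum.cong refl) (force simp: smith_kernel_self assignment_def)
      finally show ?thesis .
    qed
    then have "(\<Sum>i\<in>machines I. \<Sum>j\<in>jobs I. x i j * interaction I x i j)
       = (\<Sum>i\<in>machines I. \<Sum>j\<in>jobs I. x i j * (weight I j * job_size I j))
         + 2 * (\<Sum>i\<in>machines I. \<Sum>j\<in>jobs I. P i j)"
      by (simp add: sum.distrib sum_distrib_left)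
    moreover have "(\<Sum>i\<in>machines I. \<Sum>j\<in>jobs I. x i j * (weight I j * job_size I j)) = total_work I"
      by (subst sum.swap) (simp add: total_work_def assignment_sum_machines[OF I x]
          flip: sum_distrib_right)
    ultimately show ?thesis by simp
  qed
  finally show ?thesis by (simp add: field_simps)
qed

text \<open>Q becomes a sum over pairs of jobs sharing a machine, a form that admits comparison pair
  by pair.\<close>

lemma sum_assignment_interaction:
  assumes I: "sched_instance I" and \<sigma>: "\<And>j. j \<in> jobs I \<Longrightarrow> \<sigma> j \<in> feasible_machines I j"
    "\<And>i j. j \<in> jobs I \<Longrightarrow> i \<in> machines I \<Longrightarrow> x i j = (if i = \<sigma> j then 1 else 0)"
  shows "(\<Sum>i\<in>machines I. \<Sum>j\<in>jobs I. x i j * interaction I x i j)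
    = (\<Sum>j\<in>jobs I. \<Sum>k\<in>jobs I. if \<sigma> j = \<sigma> k then smith_kernel I j k else 0)"
proof -
  have "(\<Sum>i\<in>machines I. x i j * interaction I x i j)
      = (\<Sum>k\<in>jobs I. if \<sigma> j = \<sigma> k then smith_kernel I j k else 0)" if j: "j \<in> jobs I" for j
  proof -
    have s: "\<sigma> j \<in> machines I" using \<sigma>(1)[OF j] by (simp add: feasible_machines_def)
    have "(\<Sum>i\<in>machines I. x i j * interaction I x i j)
        = (\<Sum>i\<in>machines I. if i = \<sigma> j then interaction I x (\<sigma> j) j else 0)"
      using j \<sigma>(2) by (intro sum.cong refl) auto
    also have "\<dots> = interaction I x (\<sigma> j) j"
      using I s by (simp add: sched_instance_def)
    also have "\<dots> = (\<Sum>k\<in>jobs I. if \<sigma> j = \<sigma> k then smith_kernel I j k else 0)"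
      unfolding interaction_def using \<sigma>(2)[OF _ s] by (intro sum.cong refl) auto
    finally show ?thesis .
  qed
  then show ?thesis by (subst sum.swap) simp
qed

text \<open>The diagonal of Q already sums to W and the other terms are nonnegative, so Q is at
  least W.\<close>

lemma total_work_le_cost:
  assumes I: "sched_instance I" and x: "assignment I x"
  shows "ereal (total_work I) \<le> cost I x"
proof -
  obtain \<sigma> where \<sigma>: "\<And>j. j \<in> jobs I \<Longrightarrow> \<sigma> j \<in> feasible_machines I j"
    "\<And>i j. j \<in> jobs I \<Longrightarrow> i \<in> machines I \<Longrightarrow> x i j = (if i = \<sigma> j then 1 else 0)"
    using assignment_obtain_machine[OF I x] by metis
  have fin: "finite (jobs I)" using I by (simp add: sched_instance_def)
  have "total_work I \<le> (\<Sum>j\<in>jobs I. \<Sum>k\<in>jobs I. if \<sigma> j = \<sigma> k then smith_kernel I j k else 0)"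
    unfolding total_work_def
  proof (rule sum_mono)
    fix j assume j: "j \<in> jobs I"
    show "weight I j * job_size I j \<le> (\<Sum>k\<in>jobs I. if \<sigma> j = \<sigma> k then smith_kernel I j k else 0)"
      using member_le_sum[of j "jobs I" "\<lambda>k. if \<sigma> j = \<sigma> k then smith_kernel I j k else 0"]
        j fin smith_kernel_nonneg[OF I j] by (auto simp: smith_kernel_self)
  qed
  then show ?thesis
    using sum_assignment_interaction[OF I \<sigma>] by (simp add: cost_eq_interaction[OF I x])
qed

section \<open>Weak duality\<close>

text \<open>Only the vectors \<open>u j\<close> selected by the assignment matter. With V their sum,
  the bound on the inner product of \<open>v0\<close> and V cancels the norm of \<open>v0\<close>,
  and the pairwise constraints bound the squared norm of V by that of the single \<open>u j\<close>
  plus Q - W. What remains is W + (Q - W) / 2, the cost.\<close>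

lemma sdp_weak_duality:
  assumes I: "sched_instance I" and x: "assignment I x" and sdp: "sdp_feasible I d y v0 v"
  shows "ereal (sdp_objective I y v0) \<le> cost I x"
proof -
  obtain \<sigma> where \<sigma>: "\<And>j. j \<in> jobs I \<Longrightarrow> \<sigma> j \<in> feasible_machines I j"
    "\<And>i j. j \<in> jobs I \<Longrightarrow> i \<in> machines I \<Longrightarrow> x i j = (if i = \<sigma> j then 1 else 0)"
    using assignment_obtain_machine[OF I x] by metis
  define J where "J = jobs I"
  define u where "u j = v (\<sigma> j) j" for j
  define V where "V t = (\<Sum>j\<in>J. u j $ t)" for t
  have fin: "finite J" using I by (simp add: sched_instance_def J_def)
  have v0: "v0 \<in> carrier_vec d" and u: "\<And>j. j \<in> J \<Longrightarrow> u j \<in> carrier_vec d"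
    using sdp \<sigma>(1) by (auto simp: sdp_feasible_def u_def J_def)
  have sp: "a \<bullet> b = (\<Sum>t<d. a $ t * b $ t)" if "b \<in> carrier_vec d" for a b :: "real vec"
    using that by (simp add: scalar_prod_def atLeast0LessThan carrier_vecD)
  have y: "y j \<le> weight I j * job_size I j - u j \<bullet> u j / 2 + v0 \<bullet> u j" if "j \<in> J" for j
  proof -
    have "ereal (y j) \<le> ereal (weight I j) * ptime I (\<sigma> j) j
          - ereal (1 / 2 * (u j \<bullet> u j)) + ereal (v0 \<bullet> u j)"
      using sdp \<sigma>(1) that by (auto simp: sdp_feasible_def u_def J_def)
    then show ?thesis using that \<sigma>(1) by (simp add: feasible_ptime[OF I] J_def)
  qed
  have cross: "u j \<bullet> u k \<le> (if \<sigma> j = \<sigma> k then smith_kernel I j k else 0)"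
    if "j \<in> J" "k \<in> J" "j \<noteq> k" for j k
  proof -
    have "ereal (u j \<bullet> u k) \<le> (if \<sigma> j = \<sigma> k then ereal (weight I j * weight I k) *
        min (smith_ratio I (\<sigma> j) j) (smith_ratio I (\<sigma> j) k) else 0)"
      using sdp \<sigma>(1) that by (auto simp: sdp_feasible_def u_def J_def)
    then show ?thesis
      using weighted_min_smith_ratio[OF I, of j k "\<sigma> j"] that \<sigma>(1)[of j] \<sigma>(1)[of k]
      by (auto simp: J_def split: if_splits)
  qed
  have "(\<Sum>j\<in>J. v0 \<bullet> u j) = (\<Sum>t<d. v0 $ t * V t)"
    unfolding V_def sum_distrib_left by (subst sum.swap) (simp add: sp u)
  moreover have "v0 \<bullet> v0 = (\<Sum>t<d. v0 $ t * v0 $ t)" by (simp add: sp v0)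
  \<comment> \<open>Young's inequality, coordinate by coordinate.\<close>
  moreover have "(\<Sum>t<d. v0 $ t * V t) \<le> (\<Sum>t<d. v0 $ t * v0 $ t) / 2 + (\<Sum>t<d. V t * V t) / 2"
  proof -
    have "v0 $ t * V t \<le> v0 $ t * v0 $ t / 2 + V t * V t / 2" for t
      using zero_le_square[of "v0 $ t - V t"] by (simp add: algebra_simps)
    then show ?thesis by (simp add: sum_divide_distrib sum_mono flip: sum.distrib)
  qed
  moreover have "(\<Sum>t<d. V t * V t) = (\<Sum>j\<in>J. \<Sum>k\<in>J. u j \<bullet> u k)"
  proof -
    have "(\<Sum>t<d. V t * V t) = (\<Sum>t<d. \<Sum>j\<in>J. \<Sum>k\<in>J. u j $ t * u k $ t)"
      by (simp add: V_def sum_product)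
    also have "\<dots> = (\<Sum>j\<in>J. \<Sum>t<d. \<Sum>k\<in>J. u j $ t * u k $ t)" by (rule sum.swap)
    also have "\<dots> = (\<Sum>j\<in>J. \<Sum>k\<in>J. \<Sum>t<d. u j $ t * u k $ t)"
      by (intro sum.cong refl) (rule sum.swap)
    finally show ?thesis by (simp add: sp u)
  qed
  \<comment> \<open>The constraints cover distinct pairs only: the diagonal keeps its norms, and the
    diagonal of the kernel, which is W, is subtracted.\<close>
  moreover have "(\<Sum>j\<in>J. \<Sum>k\<in>J. u j \<bullet> u k)
      \<le> (\<Sum>j\<in>J. u j \<bullet> u j) + (\<Sum>j\<in>J. \<Sum>k\<in>J. if \<sigma> j = \<sigma> k then smith_kernel I j k else 0) - total_work I"
  proof -
    have "(\<Sum>k\<in>J. u j \<bullet> u k) \<le> u j \<bullet> u j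
       + (\<Sum>k\<in>J. if \<sigma> j = \<sigma> k then smith_kernel I j k else 0) - weight I j * job_size I j"
      if j: "j \<in> J" for j
    proof -
      have "(\<Sum>k\<in>J - {j}. u j \<bullet> u k)
          \<le> (\<Sum>k\<in>J - {j}. if \<sigma> j = \<sigma> k then smith_kernel I j k else 0)"
        by (intro sum_mono cross j) auto
      then show ?thesis by (simp add: sum.remove[OF fin j] smith_kernel_self)
    qed
    then have "(\<Sum>j\<in>J. \<Sum>k\<in>J. u j \<bullet> u k) \<le> (\<Sum>j\<in>J. u j \<bullet> u j
       + (\<Sum>k\<in>J. if \<sigma> j = \<sigma> k then smith_kernel I j k else 0) - weight I j * job_size I j)"
      by (rule sum_mono)
    then show ?thesis
      by (simp add: total_work_def J_def sum.distrib sum_subtractf)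
  qed
  moreover have "(\<Sum>j\<in>J. y j) \<le> total_work I - (\<Sum>j\<in>J. u j \<bullet> u j) / 2 + (\<Sum>j\<in>J. v0 \<bullet> u j)"
    using sum_mono[of J, OF y]
    by (simp add: total_work_def J_def sum.distrib sum_subtractf sum_divide_distrib)
  ultimately show ?thesis
    using sum_assignment_interaction[OF I \<sigma>]
    by (simp add: cost_eq_interaction[OF I x] sdp_objective_def J_def)
qed

section \<open>Gram vectors for the kernel\<close>

text \<open>The minimum of two nonnegative reals is the overlap of the intervals from 0 to each. The
  induction builds the vectors in increasing order, one new coordinate per increment.\<close>

lemma min_kernel_gram:
  fixes A :: "real set"
  assumes "finite A" "\<And>a. a \<in> A \<Longrightarrow> 0 \<le> a"
  shows "\<exists>(d::nat) g. \<forall>a\<in>A. \<forall>b\<in>A. min a b = (\<Sum>t<d. g a t * g b t)"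
  using assms
proof (induction A rule: finite_linorder_max_induct)
  case empty
  then show ?case by simp
next
  case (insert b A)
  have "\<exists>(d::nat) g. \<forall>a\<in>A. \<forall>b\<in>A. min a b = (\<Sum>t<d. g a t * g b t)"
    using insert.IH insert.prems by simp
  then obtain d :: nat and g where
    g: "\<And>a c. a \<in> A \<Longrightarrow> c \<in> A \<Longrightarrow> min a c = (\<Sum>t<d. g a t * g c t)"
    by blast
  have "\<exists>m h. 0 \<le> m \<and> m \<le> b \<and> m = (\<Sum>t<d. h t * h t)
      \<and> (\<forall>a\<in>A. a = (\<Sum>t<d. g a t * h t))"
    \<comment> \<open>\<open>h\<close> is the vector of the current maximum; the new vector extends it by one coordinate.\<close>
  proof (cases "A = {}")
    case True
    then show ?thesis using insert.prems by (intro exI[of _ 0] exI[of _ "\<lambda>_. 0"]) auto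
  next
    case False
    have m: "Max A \<in> A" using False insert.hyps by simp
    have "\<forall>a\<in>A. a = (\<Sum>t<d. g a t * g (Max A) t)"
      using g[OF _ m] insert.hyps(1) by (metis Max_ge min_def)
    moreover have "Max A \<le> b" using insert.hyps(2) m by force
    ultimately show ?thesis using m insert.prems
      by (intro exI[of _ "Max A"] exI[of _ "g (Max A)"]) auto
  qed
  then obtain m h where h: "0 \<le> m" "m \<le> b" "m = (\<Sum>t<d. h t * h t)"
      "\<And>a. a \<in> A \<Longrightarrow> a = (\<Sum>t<d. g a t * h t)" by blast
  \<comment> \<open>Against smaller elements the last coordinate vanishes, so \<open>b\<close>
    behaves like \<open>h\<close>; its own squared norm is m + (b - m) = b.\<close>
  define g' where "g' a t = (if a = b then (if t < d then h t else sqrt (b - m))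
    else (if t < d then g a t else 0))" for a t
  have bA: "\<And>a. a \<in> A \<Longrightarrow> a < b" using insert.hyps by blast
  have h': "a = (\<Sum>t<d. h t * g a t)" if "a \<in> A" for a
    using h(4)[OF that] by (simp add: mult.commute)
  have "min a c = (\<Sum>t<Suc d. g' a t * g' c t)" if "a \<in> insert b A" "c \<in> insert b A" for a c
  proof (cases "a = b"; cases "c = b")
    assume "a = b" "c = b"
    then show ?thesis using h(2,3) by (simp add: g'_def)
  next
    assume "a = b" "c \<noteq> b"
    then show ?thesis using h'[of c] bA[of c] that by (simp add: g'_def)
  next
    assume "a \<noteq> b" "c = b"
    then show ?thesis using h(4)[of a] bA[of a] that by (simp add: g'_def)
  next
    assume "a \<noteq> b" "c \<noteq> b"
    then show ?thesis using g[of a c] that by (simp add: g'_def)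
  qed
  then show ?case by blast
qed

text \<open>The Gram vector of the ratio of job j is scaled by the weight of j.\<close>

lemma smith_kernel_gram:
  assumes I: "sched_instance I"
  obtains d :: nat and e where
    "\<And>j k. j \<in> jobs I \<Longrightarrow> k \<in> jobs I \<Longrightarrow> smith_kernel I j k = (\<Sum>t<d. e j t * e k t)"
proof -
  define \<delta> where "\<delta> j = job_size I j / weight I j" for j
  have "finite (\<delta> ` jobs I)" "\<And>a. a \<in> \<delta> ` jobs I \<Longrightarrow> 0 \<le> a"
    using I by (auto simp: sched_instance_def \<delta>_def)
  then obtain d :: nat and g where
    g: "\<forall>a\<in>\<delta> ` jobs I. \<forall>b\<in>\<delta> ` jobs I. min a b = (\<Sum>t<d. g a t * g b t)"
    using min_kernel_gram by blast
  have "smith_kernel I j k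
      = (\<Sum>t<d. (weight I j * g (\<delta> j) t) * (weight I k * g (\<delta> k) t))"
    if "j \<in> jobs I" "k \<in> jobs I" for j k
    using g that unfolding smith_kernel_def \<delta>_def[symmetric]
    by (simp add: sum_distrib_left mult_ac)
  then show ?thesis by (rule that)
qed

section \<open>Local optimality in terms of interactions\<close>

lemma assignment_move_job:
  assumes I: "sched_instance I" and x: "assignment I x"
    and j: "j \<in> jobs I" and i: "i \<in> feasible_machines I j"
  shows "assignment I (move_job x j i)"
proof -
  have "finite (feasible_machines I j)"
    using I by (simp add: sched_instance_def feasible_machines_def)
  then have "(\<Sum>m\<in>feasible_machines I k. move_job x j i m k) = 1" if "k \<in> jobs I" for k
    using x i that by (cases "k = j") (auto simp: assignment_def move_job_def)
  then show ?thesis using x i by (auto simp: assignment_def move_job_def)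
qed

text \<open>The sum on the left picks the machine of \<open>j\<close>. A jump adds
  \<open>e j\<close> to the vector \<open>F\<close> of the new machine and subtracts it from that of
  the old one; W is unchanged, so the expanded change of Q must be nonnegative.\<close>

lemma jump_opt_interaction:
  assumes I: "sched_instance I" and x: "jump_opt I x"
    and j: "j \<in> jobs I" and i: "i \<in> feasible_machines I j"
  shows "(\<Sum>m\<in>machines I. x m j * interaction I x m j)
    \<le> weight I j * job_size I j + interaction I x i j"
proof -
  have ax: "assignment I x" using x by (simp add: jump_opt_def)
  obtain \<sigma> where \<sigma>: "\<And>j. j \<in> jobs I \<Longrightarrow> \<sigma> j \<in> feasible_machines I j"
    "\<And>i j. j \<in> jobs I \<Longrightarrow> i \<in> machines I \<Longrightarrow> x i j = (if i = \<sigma> j then 1 else 0)"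
    using assignment_obtain_machine[OF I ax] by metis
  have fin: "finite (machines I)" "finite (jobs I)" using I by (auto simp: sched_instance_def)
  have sj: "\<sigma> j \<in> machines I" and im: "i \<in> machines I"
    using \<sigma>(1)[OF j] i by (auto simp: feasible_machines_def)
  have own: "(\<Sum>m\<in>machines I. x m j * c m) = c (\<sigma> j)" for c :: "_ \<Rightarrow> real"
  proof -
    have "(\<Sum>m\<in>machines I. x m j * c m) = (\<Sum>m\<in>machines I. if m = \<sigma> j then c (\<sigma> j) else 0)"
      using \<sigma>(2)[OF j] by (intro sum.cong) auto
    then show ?thesis using fin sj by simp
  qed
  show ?thesis
  proof (cases "i = \<sigma> j")
    case True
    then show ?thesis using own j smith_kernel_nonneg[OF I j j] by (simp add: smith_kernel_self)
  next
    case False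
    obtain d :: nat and e where
      e: "\<And>j k. j \<in> jobs I \<Longrightarrow> k \<in> jobs I \<Longrightarrow> smith_kernel I j k = (\<Sum>t<d. e j t * e k t)"
      using smith_kernel_gram[OF I] by metis
    define F where "F z m t = (\<Sum>k\<in>jobs I. z m k * e k t)" for z :: "'a \<Rightarrow> 'b \<Rightarrow> real" and m t
    have inter: "interaction I z m k = (\<Sum>t<d. e k t * F z m t)" if "k \<in> jobs I" for z m k
      unfolding interaction_def F_def sum_distrib_left
      by (subst sum.swap) (simp add: e that sum_distrib_left mult_ac)
    have quad: "(\<Sum>k\<in>jobs I. z m k * interaction I z m k) = (\<Sum>t<d. F z m t * F z m t)" for z m
    proof -
      have "(\<Sum>k\<in>jobs I. z m k * interaction I z m k)
          = (\<Sum>k\<in>jobs I. \<Sum>t<d. z m k * e k t * F z m t)"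
        by (simp add: inter sum_distrib_left mult.assoc)
      also have "\<dots> = (\<Sum>t<d. F z m t * F z m t)"
        by (subst sum.swap) (simp add: F_def sum_distrib_right)
      finally show ?thesis .
    qed
    define z where "z = move_job x j i"
    define D where "D m = (if m = i then 1 else 0) - x m j" for m
    have F': "F z m t = F x m t + D m * e j t" for m t
      unfolding F_def D_def z_def move_job_def
      by (simp add: sum.remove[OF fin(2) j] algebra_simps)
    have diff: "(\<Sum>k\<in>jobs I. z m k * interaction I z m k) = (\<Sum>k\<in>jobs I. x m k * interaction I x m k)
        + 2 * (D m * interaction I x m j) + D m * D m * smith_kernel I j j" for m
      unfolding quad unfolding F' by (simp add: inter e j sum_distrib_left sum.distrib algebra_simps)
    have az: "assignment I z" unfolding z_def by (rule assignment_move_job[OF I ax j i])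
    have "\<not> cost I z < cost I x"
      using x j i False im \<sigma>(2)[OF j im] by (simp add: jump_opt_def z_def)
    then have "0 \<le> (\<Sum>m\<in>machines I. 2 * (D m * interaction I x m j) + D m * D m * smith_kernel I j j)"
      by (simp add: cost_eq_interaction[OF I ax] cost_eq_interaction[OF I az] diff sum.distrib)
    \<comment> \<open>\<open>D\<close> is 1 on the new machine, -1 on the old one and 0 elsewhere,
      so its square is 1 on both.\<close>
    also have "\<dots> = (\<Sum>m\<in>machines I. (if m = i then 2 * interaction I x i j + smith_kernel I j j else 0)
        + x m j * (smith_kernel I j j - 2 * interaction I x m j))"
      using \<sigma>(2)[OF j] False by (intro sum.cong refl) (auto simp: D_def)
    also have "\<dots> = 2 * interaction I x i j + smith_kernel I j j
        + (smith_kernel I j j - 2 * interaction I x (\<sigma> j) j)"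
      using fin im by (simp add: sum.distrib own)
    finally show ?thesis unfolding own smith_kernel_self by linarith
  qed
qed

section \<open>The fitted SDP solution\<close>

text \<open>The orthogonal copies are indexed by pairs of a machine and a coordinate; an enumeration
  turns these into natural vector indices.\<close>

lemma vec_family_of_finite_index:
  assumes "finite T"
  obtains vec_of :: "('a \<Rightarrow> real) \<Rightarrow> real vec" where
    "\<And>f. vec_of f \<in> carrier_vec (card T)"
    "\<And>f g. vec_of f \<bullet> vec_of g = (\<Sum>t\<in>T. f t * g t)"
proof -
  obtain h where h: "bij_betw h {0..<card T} T"
    using ex_bij_betw_nat_finite[OF assms] by blast
  show ?thesis
  proof
    show "vec (card T) (\<lambda>n. f (h n)) \<in> carrier_vec (card T)" for f :: "'a \<Rightarrow> real" by simp
    show "vec (card T) (\<lambda>n. f (h n)) \<bullet> vec (card T) (\<lambda>n. g (h n)) = (\<Sum>t\<in>T. f t * g t)"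
      for f g :: "'a \<Rightarrow> real"
      using sum.reindex_bij_betw[OF h, of "\<lambda>t. f t * g t"] by (simp add: scalar_prod_def)
  qed
qed

text \<open>The value is exact: the sum on the right is Q = 2 C(x) - W. Replacing W by the optimal
  cost happens only in the final theorem.\<close>

lemma jump_opt_sdp_fitting:
  assumes I: "sched_instance I" and x: "jump_opt I x"
  obtains d y v0 v where "sdp_feasible I d y v0 v"
    "sdp_objective I y v0 = 2 / (3 + sqrt 5) *
       (\<Sum>i\<in>machines I. \<Sum>j\<in>jobs I. x i j * interaction I x i j)"
proof -
  have fin: "finite (machines I)" "finite (jobs I)" using I by (auto simp: sched_instance_def)
  obtain d :: nat and e where
    e: "\<And>j k. j \<in> jobs I \<Longrightarrow> k \<in> jobs I \<Longrightarrow> smith_kernel I j k = (\<Sum>t<d. e j t * e k t)"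
    using smith_kernel_gram[OF I] by metis
  define T where "T = machines I \<times> {..<d}"
  have finT: "finite T" using fin by (simp add: T_def)
  obtain vec_of :: "('a \<times> nat \<Rightarrow> real) \<Rightarrow> real vec" where
    vc: "\<And>f. vec_of f \<in> carrier_vec (card T)" and
    vp: "\<And>f g. vec_of f \<bullet> vec_of g = (\<Sum>t\<in>T. f t * g t)"
    using vec_family_of_finite_index[OF finT] by metis
  have vp': "vec_of f \<bullet> vec_of g = (\<Sum>m\<in>machines I. \<Sum>t<d. f (m, t) * g (m, t))" for f g
    unfolding vp T_def by (simp add: sum.cartesian_product)
  \<comment> \<open>The maximiser of \<open>\<alpha>\<beta> - \<alpha>\<^sup>2 / 2\<close> subject to \<open>\<beta>\<^sup>2 / 2 + \<alpha>\<beta> = 1\<close>.\<close>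
  define s \<alpha> \<beta> where "s = 1 / sqrt 5" and "\<alpha> = sqrt (3 * s - 1)" and "\<beta> = sqrt (2 * s)"
  have s2: "s * s = 1 / 5" by (simp add: s_def)
  have s0: "0 \<le> s" by (simp add: s_def)
  \<comment> \<open>The lower bound makes the radicand of \<open>\<alpha>\<close> nonnegative. The
    upper bound on \<open>s\<close> gives \<open>\<beta> * \<beta> \<le> 1\<close>, needed for the
    pairwise constraints.\<close>
  have s1: "1 / 3 \<le> s" by (rule power2_le_imp_le) (simp_all add: power2_eq_square s2 s0)
  have s3: "s \<le> 1 / 2" by (rule power2_le_imp_le) (simp_all add: power2_eq_square s2)
  have a2: "\<alpha> * \<alpha> = 3 * s - 1" using s1 by (simp add: \<alpha>_def)
  have b2: "\<beta> * \<beta> = 2 * s" using s0 by (simp add: \<beta>_def)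
  have ab: "\<alpha> * \<beta> = 1 - s"
  proof -
    have "(3 * s - 1) * (2 * s) = (1 - s)\<^sup>2"
      using s2 by (simp add: power2_eq_square algebra_simps)
    then show ?thesis using s3 by (simp add: \<alpha>_def \<beta>_def flip: real_sqrt_mult)
  qed
  \<comment> \<open>The right side is \<open>\<alpha> * \<beta> - \<alpha> * \<alpha> / 2\<close>
    written in \<open>s\<close>.\<close>
  have kappa: "2 / (3 + sqrt 5) = (3 - 5 * s) / 2"
  proof -
    have "5 * s = sqrt 5" by (simp add: s_def real_div_sqrt)
    moreover have "2 / (3 + sqrt 5) = (3 - sqrt 5) / 2"
    proof (subst frac_eq_eq)
      show "3 + sqrt 5 \<noteq> 0" using real_sqrt_ge_zero[of 5] by linarith
      show "2 * 2 = (3 - sqrt 5) * (3 + sqrt 5)" by (simp add: algebra_simps)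
    qed simp
    ultimately show ?thesis by simp
  qed
  define F where "F m t = (\<Sum>k\<in>jobs I. x m k * e k t)" for m t
  have inter: "interaction I x m k = (\<Sum>t<d. F m t * e k t)" if "k \<in> jobs I" for m k
    unfolding interaction_def F_def sum_distrib_right
    by (subst sum.swap) (simp add: e that sum_distrib_left mult_ac)
  have quad: "(\<Sum>k\<in>jobs I. x m k * interaction I x m k) = (\<Sum>t<d. F m t * F m t)" for m
  proof -
    have "(\<Sum>k\<in>jobs I. x m k * interaction I x m k)
        = (\<Sum>k\<in>jobs I. \<Sum>t<d. F m t * (x m k * e k t))"
      by (simp add: inter sum_distrib_left mult_ac)
    also have "\<dots> = (\<Sum>t<d. F m t * F m t)"
      by (subst sum.swap) (simp add: F_def sum_distrib_left)
    finally show ?thesis .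
  qed
  define y where "y j = (1 - s) * (\<Sum>m\<in>machines I. x m j * interaction I x m j)" for j
  define v0 where "v0 = vec_of (\<lambda>(m, t). \<alpha> * F m t)"
  define v where "v i j = vec_of (\<lambda>(m, t). if m = i then \<beta> * e j t else 0)" for i j
  have vv: "v i j \<bullet> v i' k = (if i = i' then 2 * s * smith_kernel I j k else 0)"
    if "j \<in> jobs I" "k \<in> jobs I" "i \<in> machines I" for i i' j k
  proof -
    have "v i j \<bullet> v i' k = (\<Sum>m\<in>machines I. if m = i then
        (if i = i' then (\<Sum>t<d. \<beta> * \<beta> * (e j t * e k t)) else 0) else 0)"
      unfolding v_def vp' by (intro sum.cong refl) (auto simp: mult_ac)
    also have "\<dots> = (if i = i' then (\<Sum>t<d. \<beta> * \<beta> * (e j t * e k t)) else 0)"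
      using fin that by simp
    finally show ?thesis using that by (simp add: e sum_distrib_left b2)
  qed
  have v0v: "v0 \<bullet> v i j = (1 - s) * interaction I x i j"
    if "j \<in> jobs I" "i \<in> machines I" for i j
  proof -
    have "v0 \<bullet> v i j = (\<Sum>m\<in>machines I. if m = i then (\<Sum>t<d. \<alpha> * \<beta> * (F i t * e j t)) else 0)"
      unfolding v_def v0_def vp' by (intro sum.cong refl) (auto simp: mult_ac)
    also have "\<dots> = (\<Sum>t<d. \<alpha> * \<beta> * (F i t * e j t))"
      using fin that by simp
    finally show ?thesis using that by (simp add: inter sum_distrib_left ab)
  qed
  have v0v0: "v0 \<bullet> v0 = (3 * s - 1) * (\<Sum>i\<in>machines I. \<Sum>j\<in>jobs I. x i j * interaction I x i j)"
    unfolding v0_def vp' quad sum_distrib_left a2[symmetric] by (simp add: mult_ac)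
  have "sdp_feasible I (card T) y v0 v"
    unfolding sdp_feasible_def
  proof (intro conjI ballI impI)
    show "v0 \<in> carrier_vec (card T)" "\<And>i j. v i j \<in> carrier_vec (card T)"
      by (simp_all add: v0_def v_def vc)
  next
    fix j i assume j: "j \<in> jobs I" and i: "i \<in> feasible_machines I j"
    have im: "i \<in> machines I" using i by (simp add: feasible_machines_def)
    \<comment> \<open>The norm term takes the share \<open>s\<close> of the work of
      \<open>j\<close>, so the constraint is the jump inequality scaled by
      \<open>1 - s\<close>.\<close>
    have "y j \<le> (1 - s) * (weight I j * job_size I j + interaction I x i j)"
      unfolding y_def using jump_opt_interaction[OF I x j i] s3 by (intro mult_left_mono) auto
    then show "ereal (y j) \<le> ereal (weight I j) * ptime I i j
          - ereal (1 / 2 * (v i j \<bullet> v i j)) + ereal (v0 \<bullet> v i j)"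
      using vv[OF j j im, of i] v0v[OF j im] feasible_ptime[OF I j i]
      by (simp add: smith_kernel_self algebra_simps)
  next
    fix j k i i'
    assume j: "j \<in> jobs I" and k: "k \<in> jobs I"
      and i: "i \<in> feasible_machines I j" and i': "i' \<in> feasible_machines I k"
    have im: "i \<in> machines I" using i by (simp add: feasible_machines_def)
    have "2 * s * smith_kernel I j k \<le> 1 * smith_kernel I j k"
      using s3 smith_kernel_nonneg[OF I j k] by (intro mult_right_mono) auto
    then show "ereal (v i j \<bullet> v i' k) \<le> (if i = i'
           then ereal (weight I j * weight I k) * min (smith_ratio I i j) (smith_ratio I i k) else 0)"
      using vv[OF j k im, of i'] weighted_min_smith_ratio[OF I j k i] i' by auto
  qed
  moreover have "sdp_objective I y v0 = 2 / (3 + sqrt 5) *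
       (\<Sum>i\<in>machines I. \<Sum>j\<in>jobs I. x i j * interaction I x i j)"
  proof -
    have "(\<Sum>j\<in>jobs I. y j) = (1 - s) * (\<Sum>i\<in>machines I. \<Sum>j\<in>jobs I. x i j * interaction I x i j)"
      unfolding y_def sum_distrib_left[symmetric] by (subst sum.swap) simp
    then show ?thesis unfolding sdp_objective_def v0v0 kappa by (simp add: algebra_simps)
  qed
  ultimately show ?thesis by (rule that)
qed

theorem theorem6p3:
  fixes I :: "('m, 'j) sched" and x xopt :: "'m \<Rightarrow> 'j \<Rightarrow> real"
  assumes "sched_instance I"
    and "jump_opt I x"
    and "optimal_assignment I xopt"
  shows "(\<exists>d y v0 v. sdp_feasible I d y v0 v \<and>
            ereal (sdp_objective I y v0) \<ge> ereal (2 / (3 + sqrt 5)) * (2 * cost I x - cost I xopt))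
         \<and> cost I x \<le> ereal ((5 + sqrt 5) / 4) * cost I xopt"
proof -
  note I = assms(1)
  have ax: "assignment I x" and ao: "assignment I xopt"
    using assms by (auto simp: jump_opt_def optimal_assignment_def)
  define Q where "Q = (\<Sum>i\<in>machines I. \<Sum>j\<in>jobs I. x i j * interaction I x i j)"
  define \<kappa> where "\<kappa> = 2 / (3 + sqrt 5)"
  obtain c where c: "cost I xopt = ereal c" using cost_eq_interaction[OF I ao] by blast
  have Cx: "cost I x = ereal ((total_work I + Q) / 2)"
    using cost_eq_interaction[OF I ax] by (simp add: Q_def)
  have Pc: "total_work I \<le> c" using total_work_le_cost[OF I ao] by (simp add: c)
  have pos: "0 < 3 + sqrt 5" using real_sqrt_ge_zero[of 5] by linarith
  then have k0: "0 < \<kappa>" by (simp add: \<kappa>_def)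
  obtain d y v0 v where f: "sdp_feasible I d y v0 v" and obj: "sdp_objective I y v0 = \<kappa> * Q"
    unfolding Q_def \<kappa>_def by (rule jump_opt_sdp_fitting[OF I assms(2)])
  have val: "\<kappa> * (total_work I + Q - c) \<le> \<kappa> * Q"
    using Pc k0 by (intro mult_left_mono) auto
  \<comment> \<open>Weak duality is applied to the optimal assignment, with the solution fitted to
    \<open>x\<close>.\<close>
  have "\<kappa> * Q \<le> c" using sdp_weak_duality[OF I ao f] by (simp add: obj c)
  with val have "\<kappa> * (total_work I + Q) \<le> (1 + \<kappa>) * c" by (simp add: algebra_simps)
  then have "(total_work I + Q) / 2 \<le> (1 + \<kappa>) / (2 * \<kappa>) * c"
    using k0 by (simp add: field_simps)
  \<comment> \<open>The quotient is 1 / (2 \<open>\<kappa>\<close>) + 1 / 2, that is (3 + sqrt 5) /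
    4 + 2 / 4.\<close>
  also have "(1 + \<kappa>) / (2 * \<kappa>) = (5 + sqrt 5) / 4"
    using pos by (simp add: \<kappa>_def field_simps)
  finally have ratio: "cost I x \<le> ereal ((5 + sqrt 5) / 4) * cost I xopt"
    by (simp add: Cx c)
  have "2 * cost I x = ereal (total_work I + Q)"
    unfolding Cx numeral_eq_ereal times_ereal.simps by simp
  then have "ereal \<kappa> * (2 * cost I x - cost I xopt) \<le> ereal (sdp_objective I y v0)"
    using val by (simp add: obj c)
  with f ratio show ?thesis unfolding \<kappa>_def by blast
qed

end
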